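(* For all $\mathsf{PTS}\alpha$ terms $t,u$: if $t\to_\beta u$ then $\mathcal A(t)\to_{\mathsf{Bx}'}^+\mathcal A(u)$. (That is, $\mathsf{Bx}'$-reduction strongly simulates $\beta$-reduction through $\mathcal A$.)
   Context: Fix a set $\mathcal S$ of sorts, a denumerable set of variables, and two denumerable sets of meta-variables: term meta-variables $\alpha$ and list meta-variables $\beta$, each with a fixed arity. $\mathsf{PTSC}\alpha$ terms and lists: $M ::= \Pi x^{A}.B \mid \lambda x^{A}.M \mid s \mid x\,l \mid M\,l \mid \langle N/x\rangle_A M \mid \alpha(M_1,\dots,M_n)$, $l ::= [\,] \mid M\cdot l \mid l @ l' \mid \langle N/x\rangle_A l \mid \beta(M_1,\dots,M_n)$ ($\langle N/x\rangle_A$ explicit substitution binding $x$; $\Pi,\lambda$ bind $x$; up to $\alpha$-conversion). Reduction: (B) $(\lambda x^A.M)\,(N\cdot l)\to(\langle N/x\rangle_A M)\,l$; system $\mathsf{x}'$: (B1) $M\,[\,]\to M$; (B2) $(x\,l)\,l'\to x\,(l@l')$; (B3) $(M\,l)\,l'\to M\,(l@l')$; (A1) $(M\cdot l')@l\to M\cdot(l'@l)$; (A2) $[\,]@l\to l$; (A3) $(l@l')@l''\to l@(l'@l'')$; (A4) $l@[\,]\to l$; (C1) $\langle P/y\rangle_G(\lambda x^A.M)\to\lambda x^{\langle P/y\rangle_G A}.\langle P/y\rangle_G M$; (C2) $\langle P/y\rangle_G(y\,l)\to P\,(\langle P/y\rangle_G l)$; (C3) $\langle P/y\rangle_G(x\,l)\to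 x\,(\langle P/y\rangle_G l)$ if $x\neq y$; (C4) $\langle P/y\rangle_G(M\,l)\to(\langle P/y\rangle_G M)\,(\langle P/y\rangle_G l)$; (C5) $\langle P/y\rangle_G(\Pi x^A.B)\to\Pi x^{\langle P/y\rangle_G A}.\langle P/y\rangle_G B$; (C6) $\langle P/y\rangle_G s\to s$; (C$\alpha$) $\langle P/y\rangle_G\alpha(M_1,\dots,M_n)\to\alpha(\langle P/y\rangle_G M_1,\dots)$; (D1) $\langle P/y\rangle_G[\,]\to[\,]$; (D2) $\langle P/y\rangle_G(M\cdot l)\to(\langle P/y\rangle_G M)\cdot(\langle P/y\rangle_G l)$; (D3) $\langle P/y\rangle_G(l@l')\to(\langle P/y\rangle_G l)@(\langle P/y\rangle_G l')$; (D$\beta$) $\langle P/y\rangle_G\beta(M_1,\dots,M_n)\to\beta(\langle P/y\rangle_G M_1,\dots)$. $\to_{\mathsf{Bx}'}$ is the contextual closure of all rules; $\to^+$ its transitive closure. PTS terms $t,u,T ::= x\mid s\mid\Pi x^T.t\mid\lambda x^T.t\mid t\,u$; $\to_\beta$ is the contextual closure of $(\lambda x^v.t)\,u\to t\{x:=u\}$ (capture-avoiding substitution). For each term (resp. list) meta-variable $\alpha$ (resp. $\beta$) of arity $k$ a PTS variable $\alpha^k$ (resp. $\beta^k$) is reserved. $\mathsf{PTS}\alpha$ is the set of PTS terms in which no reserved variable is bound, each $\alpha^k$ is applied to at least $k$ arguments and each $\beta^k$ to at least $k+1$ arguments. Translation $\mathcal A$ from $\mathsf{PTS}\alpha$ to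 $\mathsf{PTSC}\alpha$: $\mathcal A(s)=s$, $\mathcal A(\Pi x^T.U)=\Pi x^{\mathcal A(T)}.\mathcal A(U)$, $\mathcal A(\lambda x^T.t)=\lambda x^{\mathcal A(T)}.\mathcal A(t)$, $\mathcal A(\alpha^k\,t_1\cdots t_k)=\alpha(\mathcal A(t_1),\dots,\mathcal A(t_k))$, $\mathcal A(\beta^k\,t\,t_1\cdots t_k)=\mathcal A_{\beta(\mathcal A(t_1),\dots,\mathcal A(t_k))}(t)$, $\mathcal A(t)=\mathcal A_{[\,]}(t)$ otherwise; $\mathcal A_l(\alpha^k\,t_1\cdots t_k)=\alpha(\mathcal A(t_1),\dots,\mathcal A(t_k))\,l$, $\mathcal A_l(\beta^k\,t\,t_1\cdots t_k)=\mathcal A_{\beta(\mathcal A(t_1),\dots,\mathcal A(t_k))@l}(t)$, $\mathcal A_l(t\,u)=\mathcal A_{\mathcal A(u)\cdot l}(t)$ otherwise, $\mathcal A_l(x)=x\,l$, $\mathcal A_l(t)=\mathcal A(t)\,l$ otherwise (in the displayed $\alpha^k$, $\beta^k$ cases the reserved variable is applied to exactly $k$, resp. $k+1$, arguments). *)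

theory Defs
  imports Main
begin

text \<open>
  Terms are taken up to alpha-conversion and are represented with de Bruijn indices: every binder
  binds index 0 of its scope, and an index that points outside all the enclosing binders denotes
  a free variable.  Both denumerable sets of meta-variables are \<^typ>\<open>nat\<close>; their arities
  are two arbitrary functions \<open>tar\<close> (term meta-variables) and \<open>lar\<close> (list
  meta-variables), which are parameters of everything that depends on arities.
  Sorts are the elements of the type \<open>'s\<close>.
\<close>

section \<open>Terms and lists with meta-variables\<close>

text \<open>
  \<open>Sub P G M\<close> is the explicit substitution of \<open>P\<close> (annotated with \<open>G\<close>)
  for index 0 in \<open>M\<close>; it binds in \<open>M\<close> only.  Likewise \<open>LSub P G l\<close>.
\<close>

datatype 's tm =
    Pi "'s tm" "'s tm"
  | Lam "'s tm" "'s tm"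
  | Sort 's
  | Var nat "'s lst"
  | App "'s tm" "'s lst"
  | Sub "'s tm" "'s tm" "'s tm"
  | TMeta nat "'s tm list"
and 's lst =
    LNil
  | LCons "'s tm" "'s lst"
  | LAppend "'s lst" "'s lst"
  | LSub "'s tm" "'s tm" "'s lst"
  | LMeta nat "'s tm list"

primrec ptsc_tm :: "(nat \<Rightarrow> nat) \<Rightarrow> (nat \<Rightarrow> nat) \<Rightarrow> 's tm \<Rightarrow> bool"
  and ptsc_lst :: "(nat \<Rightarrow> nat) \<Rightarrow> (nat \<Rightarrow> nat) \<Rightarrow> 's lst \<Rightarrow> bool" where
  "ptsc_tm tar lar (Pi A B) \<longleftrightarrow> ptsc_tm tar lar A \<and> ptsc_tm tar lar B"
| "ptsc_tm tar lar (Lam A M) \<longleftrightarrow> ptsc_tm tar lar A \<and> ptsc_tm tar lar M"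
| "ptsc_tm tar lar (Sort s) \<longleftrightarrow> True"
| "ptsc_tm tar lar (Var x l) \<longleftrightarrow> ptsc_lst tar lar l"
| "ptsc_tm tar lar (App M l) \<longleftrightarrow> ptsc_tm tar lar M \<and> ptsc_lst tar lar l"
| "ptsc_tm tar lar (Sub P G M) \<longleftrightarrow>
     ptsc_tm tar lar P \<and> ptsc_tm tar lar G \<and> ptsc_tm tar lar M"
| "ptsc_tm tar lar (TMeta a Ms) \<longleftrightarrow> length Ms = tar a \<and> list_all (ptsc_tm tar lar) Ms"
| "ptsc_lst tar lar LNil \<longleftrightarrow> True"
| "ptsc_lst tar lar (LCons M l) \<longleftrightarrow> ptsc_tm tar lar M \<and> ptsc_lst tar lar l"
| "ptsc_lst tar lar (LAppend l l') \<longleftrightarrow> ptsc_lst tar lar l \<and> ptsc_lst tar lar l'"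
| "ptsc_lst tar lar (LSub P G l) \<longleftrightarrow>
     ptsc_tm tar lar P \<and> ptsc_tm tar lar G \<and> ptsc_lst tar lar l"
| "ptsc_lst tar lar (LMeta b Ms) \<longleftrightarrow> length Ms = lar b \<and> list_all (ptsc_tm tar lar) Ms"

definition up :: "(nat \<Rightarrow> nat) \<Rightarrow> nat \<Rightarrow> nat" where
  "up f = case_nat 0 (\<lambda>n. Suc (f n))"

primrec ren_tm :: "(nat \<Rightarrow> nat) \<Rightarrow> 's tm \<Rightarrow> 's tm"
  and ren_lst :: "(nat \<Rightarrow> nat) \<Rightarrow> 's lst \<Rightarrow> 's lst" where
  "ren_tm f (Pi A B) = Pi (ren_tm f A) (ren_tm (up f) B)"
| "ren_tm f (Lam A M) = Lam (ren_tm f A) (ren_tm (up f) M)"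
| "ren_tm f (Sort s) = Sort s"
| "ren_tm f (Var x l) = Var (f x) (ren_lst f l)"
| "ren_tm f (App M l) = App (ren_tm f M) (ren_lst f l)"
| "ren_tm f (Sub P G M) = Sub (ren_tm f P) (ren_tm f G) (ren_tm (up f) M)"
| "ren_tm f (TMeta a Ms) = TMeta a (map (ren_tm f) Ms)"
| "ren_lst f LNil = LNil"
| "ren_lst f (LCons M l) = LCons (ren_tm f M) (ren_lst f l)"
| "ren_lst f (LAppend l l') = LAppend (ren_lst f l) (ren_lst f l')"
| "ren_lst f (LSub P G l) = LSub (ren_tm f P) (ren_tm f G) (ren_lst (up f) l)"
| "ren_lst f (LMeta b Ms) = LMeta b (map (ren_tm f) Ms)"

text \<open>
  When the substitution for \<open>y\<close> goes under the binder of \<open>x\<close> (rules C1 and C5),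
  the order of the two binders is exchanged, so that indices 0 and 1 of the body are swapped,
  and the substituted term and its annotation enter the scope of \<open>x\<close>, so that they are
  shifted.  The shift is what realises the convention that \<open>x\<close> is different from \<open>y\<close>
  and not free in \<open>P\<close> and \<open>G\<close>.
\<close>

abbreviation shift :: "'s tm \<Rightarrow> 's tm" where
  "shift \<equiv> ren_tm Suc"

abbreviation swap :: "'s tm \<Rightarrow> 's tm" where
  "swap \<equiv> ren_tm (id(0 := 1, 1 := 0))"

inductive rule_B :: "'s tm \<Rightarrow> 's tm \<Rightarrow> bool" where
  B: "rule_B (App (Lam A M) (LCons N l)) (App (Sub N A M) l)"

inductive rule_x_tm :: "'s tm \<Rightarrow> 's tm \<Rightarrow> bool" where
  B1: "rule_x_tm (App M LNil) M"
| B2: "rule_x_tm (App (Var x l) l') (Var x (LAppend l l'))"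
| B3: "rule_x_tm (App (App M l) l') (App M (LAppend l l'))"
| C1: "rule_x_tm (Sub P G (Lam A M)) (Lam (Sub P G A) (Sub (shift P) (shift G) (swap M)))"
| C2: "rule_x_tm (Sub P G (Var 0 l)) (App P (LSub P G l))"
| C3: "rule_x_tm (Sub P G (Var (Suc x) l)) (Var x (LSub P G l))"
| C4: "rule_x_tm (Sub P G (App M l)) (App (Sub P G M) (LSub P G l))"
| C5: "rule_x_tm (Sub P G (Pi A B)) (Pi (Sub P G A) (Sub (shift P) (shift G) (swap B)))"
| C6: "rule_x_tm (Sub P G (Sort s)) (Sort s)"
| C_alpha: "rule_x_tm (Sub P G (TMeta a Ms)) (TMeta a (map (Sub P G) Ms))"

inductive rule_x_lst :: "'s lst \<Rightarrow> 's lst \<Rightarrow> bool" where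
  A1: "rule_x_lst (LAppend (LCons M l') l) (LCons M (LAppend l' l))"
| A2: "rule_x_lst (LAppend LNil l) l"
| A3: "rule_x_lst (LAppend (LAppend l l') l'') (LAppend l (LAppend l' l''))"
| A4: "rule_x_lst (LAppend l LNil) l"
| D1: "rule_x_lst (LSub P G LNil) LNil"
| D2: "rule_x_lst (LSub P G (LCons M l)) (LCons (Sub P G M) (LSub P G l))"
| D3: "rule_x_lst (LSub P G (LAppend l l')) (LAppend (LSub P G l) (LSub P G l'))"
| D_beta: "rule_x_lst (LSub P G (LMeta b Ms)) (LMeta b (map (Sub P G) Ms))"

inductive ctx_tm :: "('s tm \<Rightarrow> 's tm \<Rightarrow> bool) \<Rightarrow> ('s lst \<Rightarrow> 's lst \<Rightarrow> bool)
      \<Rightarrow> 's tm \<Rightarrow> 's tm \<Rightarrow> bool"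
  and ctx_lst :: "('s tm \<Rightarrow> 's tm \<Rightarrow> bool) \<Rightarrow> ('s lst \<Rightarrow> 's lst \<Rightarrow> bool)
      \<Rightarrow> 's lst \<Rightarrow> 's lst \<Rightarrow> bool"
  for R :: "'s tm \<Rightarrow> 's tm \<Rightarrow> bool" and S :: "'s lst \<Rightarrow> 's lst \<Rightarrow> bool" where
  root_tm: "R M M' \<Longrightarrow> ctx_tm R S M M'"
| root_lst: "S l l' \<Longrightarrow> ctx_lst R S l l'"
| Pi1: "ctx_tm R S A A' \<Longrightarrow> ctx_tm R S (Pi A B) (Pi A' B)"
| Pi2: "ctx_tm R S B B' \<Longrightarrow> ctx_tm R S (Pi A B) (Pi A B')"
| Lam1: "ctx_tm R S A A' \<Longrightarrow> ctx_tm R S (Lam A M) (Lam A' M)"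
| Lam2: "ctx_tm R S M M' \<Longrightarrow> ctx_tm R S (Lam A M) (Lam A M')"
| Var: "ctx_lst R S l l' \<Longrightarrow> ctx_tm R S (Var x l) (Var x l')"
| App1: "ctx_tm R S M M' \<Longrightarrow> ctx_tm R S (App M l) (App M' l)"
| App2: "ctx_lst R S l l' \<Longrightarrow> ctx_tm R S (App M l) (App M l')"
| Sub1: "ctx_tm R S P P' \<Longrightarrow> ctx_tm R S (Sub P G M) (Sub P' G M)"
| Sub2: "ctx_tm R S G G' \<Longrightarrow> ctx_tm R S (Sub P G M) (Sub P G' M)"
| Sub3: "ctx_tm R S M M' \<Longrightarrow> ctx_tm R S (Sub P G M) (Sub P G M')"
| TMeta: "ctx_tm R S M M' \<Longrightarrow>
    ctx_tm R S (TMeta a (Ms @ M # Ns)) (TMeta a (Ms @ M' # Ns))"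
| LCons1: "ctx_tm R S M M' \<Longrightarrow> ctx_lst R S (LCons M l) (LCons M' l)"
| LCons2: "ctx_lst R S l l' \<Longrightarrow> ctx_lst R S (LCons M l) (LCons M l')"
| LAppend1: "ctx_lst R S l l' \<Longrightarrow> ctx_lst R S (LAppend l k) (LAppend l' k)"
| LAppend2: "ctx_lst R S l l' \<Longrightarrow> ctx_lst R S (LAppend k l) (LAppend k l')"
| LSub1: "ctx_tm R S P P' \<Longrightarrow> ctx_lst R S (LSub P G l) (LSub P' G l)"
| LSub2: "ctx_tm R S G G' \<Longrightarrow> ctx_lst R S (LSub P G l) (LSub P G' l)"
| LSub3: "ctx_lst R S l l' \<Longrightarrow> ctx_lst R S (LSub P G l) (LSub P G l')"
| LMeta: "ctx_tm R S M M' \<Longrightarrow>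
    ctx_lst R S (LMeta b (Ms @ M # Ns)) (LMeta b (Ms @ M' # Ns))"

text \<open>
  The contextual closure is restricted to terms that respect the arities.
\<close>

definition red_Bx :: "(nat \<Rightarrow> nat) \<Rightarrow> (nat \<Rightarrow> nat) \<Rightarrow> 's tm \<Rightarrow> 's tm \<Rightarrow> bool" where
  "red_Bx tar lar M N \<longleftrightarrow> ptsc_tm tar lar M \<and> ptsc_tm tar lar N \<and>
     ctx_tm (\<lambda>M N. rule_B M N \<or> rule_x_tm M N) rule_x_lst M N"

section \<open>Pure type systems\<close>

text \<open>
  The PTS variables are split into ordinary ones (\<open>PVar\<close>, de Bruijn indices) and the reserved
  ones \<open>TRes a\<close>, \<open>LRes b\<close> for the term meta-variable \<open>a\<close> and the list
  meta-variable \<open>b\<close>.  Binders bind ordinary variables only, which builds the requirement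
  that no reserved variable is bound into the syntax (up to alpha-conversion, bound variables can
  always be chosen to be ordinary).
\<close>

datatype 's pts =
    PVar nat
  | TRes nat
  | LRes nat
  | PSort 's
  | PPi "'s pts" "'s pts"
  | PLam "'s pts" "'s pts"
  | PApp "'s pts" "'s pts"

primrec pren :: "(nat \<Rightarrow> nat) \<Rightarrow> 's pts \<Rightarrow> 's pts" where
  "pren f (PVar x) = PVar (f x)"
| "pren f (TRes a) = TRes a"
| "pren f (LRes b) = LRes b"
| "pren f (PSort s) = PSort s"
| "pren f (PPi T U) = PPi (pren f T) (pren (up f) U)"
| "pren f (PLam T t) = PLam (pren f T) (pren (up f) t)"
| "pren f (PApp t u) = PApp (pren f t) (pren f u)"

definition pup :: "(nat \<Rightarrow> 's pts) \<Rightarrow> nat \<Rightarrow> 's pts" where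
  "pup g = case_nat (PVar 0) (\<lambda>n. pren Suc (g n))"

primrec psubst :: "(nat \<Rightarrow> 's pts) \<Rightarrow> 's pts \<Rightarrow> 's pts" where
  "psubst g (PVar x) = g x"
| "psubst g (TRes a) = TRes a"
| "psubst g (LRes b) = LRes b"
| "psubst g (PSort s) = PSort s"
| "psubst g (PPi T U) = PPi (psubst g T) (psubst (pup g) U)"
| "psubst g (PLam T t) = PLam (psubst g T) (psubst (pup g) t)"
| "psubst g (PApp t u) = PApp (psubst g t) (psubst g u)"

inductive red_beta :: "'s pts \<Rightarrow> 's pts \<Rightarrow> bool" where
  beta: "red_beta (PApp (PLam v t) u) (psubst (case_nat u PVar) t)"
| PPi1: "red_beta T T' \<Longrightarrow> red_beta (PPi T U) (PPi T' U)"
| PPi2: "red_beta U U' \<Longrightarrow> red_beta (PPi T U) (PPi T U')"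
| PLam1: "red_beta T T' \<Longrightarrow> red_beta (PLam T t) (PLam T' t)"
| PLam2: "red_beta t t' \<Longrightarrow> red_beta (PLam T t) (PLam T t')"
| PApp1: "red_beta t t' \<Longrightarrow> red_beta (PApp t u) (PApp t' u)"
| PApp2: "red_beta u u' \<Longrightarrow> red_beta (PApp t u) (PApp t u')"

text \<open>
  \<open>res_ok tar lar n t\<close>: when \<open>t\<close> is itself applied to \<open>n\<close> arguments, every
  occurrence of a reserved variable in \<open>t\<close> has the required number of arguments.
\<close>

primrec res_ok :: "(nat \<Rightarrow> nat) \<Rightarrow> (nat \<Rightarrow> nat) \<Rightarrow> nat \<Rightarrow> 's pts \<Rightarrow> bool" where
  "res_ok tar lar n (PVar x) \<longleftrightarrow> True"
| "res_ok tar lar n (TRes a) \<longleftrightarrow> tar a \<le> n"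
| "res_ok tar lar n (LRes b) \<longleftrightarrow> lar b + 1 \<le> n"
| "res_ok tar lar n (PSort s) \<longleftrightarrow> True"
| "res_ok tar lar n (PPi T U) \<longleftrightarrow> res_ok tar lar 0 T \<and> res_ok tar lar 0 U"
| "res_ok tar lar n (PLam T t) \<longleftrightarrow> res_ok tar lar 0 T \<and> res_ok tar lar 0 t"
| "res_ok tar lar n (PApp t u) \<longleftrightarrow> res_ok tar lar (n + 1) t \<and> res_ok tar lar 0 u"

definition PTSalpha :: "(nat \<Rightarrow> nat) \<Rightarrow> (nat \<Rightarrow> nat) \<Rightarrow> 's pts set" where
  "PTSalpha tar lar = {t. res_ok tar lar 0 t}"

section \<open>The translation\<close>

fun head :: "'s pts \<Rightarrow> 's pts" where
  "head (PApp t u) = head t"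
| "head t = t"

fun args :: "'s pts \<Rightarrow> 's pts list" where
  "args (PApp t u) = args t @ [u]"
| "args t = []"

lemma size_args: "u \<in> set (args t) \<Longrightarrow> size u < size t"
  by (induction t) auto

lemma size_args_Cons:
  assumes "t0 # ts = args t @ [u]" and "v = t0 \<or> v \<in> set ts"
  shows "size v \<le> size t + size u"
proof -
  have "v \<in> set (args t @ [u])"
    using assms by (metis list.set_intros)
  then show ?thesis
    using size_args[of v t] by auto
qed

fun rank :: "'s pts \<Rightarrow> nat" where
  "rank (PSort s) = 0"
| "rank (PPi T U) = 3 * size (PPi T U)"
| "rank (PLam T t) = 3 * size (PLam T t)"
| "rank t = 3 * size t + 2"

lemma rank_less: "size t < n \<Longrightarrow> rank t < 3 * n"
  by (cases t) auto

lemma rank_args: "u \<in> set (args t) \<Longrightarrow> rank u < 3 * size t"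
  by (simp add: rank_less size_args)

lemma rank_args_Cons:
  "t0 # ts = args t @ [u] \<Longrightarrow> v \<in> set ts \<Longrightarrow> rank v < 3 * (size t + size u) + 3"
  using rank_less[of v "size t + size u + 1"] size_args_Cons[of t0 ts t u v] by auto

text \<open>
  \<open>transA t\<close> and \<open>transA_l l t\<close> are the two mutually defined translations.  A reserved
  variable with too few arguments (outside \<^const>\<open>PTSalpha\<close>) gets the value
  \<^const>\<open>undefined\<close>.
\<close>

function (sequential) transA :: "(nat \<Rightarrow> nat) \<Rightarrow> (nat \<Rightarrow> nat) \<Rightarrow> 's pts \<Rightarrow> 's tm"
  and transA_l :: "(nat \<Rightarrow> nat) \<Rightarrow> (nat \<Rightarrow> nat) \<Rightarrow> 's lst \<Rightarrow> 's pts \<Rightarrow> 's tm" where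
  "transA tar lar (PSort s) = Sort s"
| "transA tar lar (PPi T U) = Pi (transA tar lar T) (transA tar lar U)"
| "transA tar lar (PLam T t) = Lam (transA tar lar T) (transA tar lar t)"
| "transA tar lar t =
    (case (head t, args t) of
       (TRes a, ts) \<Rightarrow>
         if length ts = tar a then TMeta a (map (transA tar lar) ts)
         else transA_l tar lar LNil t
     | (LRes b, t0 # ts) \<Rightarrow>
         if length ts = lar b then transA_l tar lar (LMeta b (map (transA tar lar) ts)) t0
         else transA_l tar lar LNil t
     | _ \<Rightarrow> transA_l tar lar LNil t)"
| "transA_l tar lar l (PVar x) = Var x l"
| "transA_l tar lar l (TRes a) = (if tar a = 0 then App (TMeta a []) l else undefined)"
| "transA_l tar lar l (LRes b) = undefined"
| "transA_l tar lar l (PApp t u) =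
    (case (head t, args t @ [u]) of
       (TRes a, ts) \<Rightarrow>
         if length ts = tar a then App (TMeta a (map (transA tar lar) ts)) l
         else transA_l tar lar (LCons (transA tar lar u) l) t
     | (LRes b, t0 # ts) \<Rightarrow>
         if length ts = lar b
         then transA_l tar lar (LAppend (LMeta b (map (transA tar lar) ts)) l) t0
         else transA_l tar lar (LCons (transA tar lar u) l) t
     | _ \<Rightarrow> transA_l tar lar (LCons (transA tar lar u) l) t)"
| "transA_l tar lar l t = App (transA tar lar t) l"
  by pat_completeness auto

termination
proof (relation "measure (case_sum (\<lambda>(_, _, t). rank t) (\<lambda>(_, _, _, t). 3 * size t + 1))",
    goal_cases)
qed (auto simp: less_Suc_eq_le dest: rank_args rank_args_Cons size_args_Cons
      intro: order.strict_trans2[OF rank_less[OF lessI]])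

end

theory Submission
  imports Defs
begin

text \<open>
  A term of \<^const>\<open>PTSalpha\<close> is built from ordinary constructors and from saturated
  reserved variables, that is, reserved variables with exactly the number of arguments that they
  need; all the proofs about the translation are inductions on this structure.  Three facts
  about reduction carry the simulation: \<open>transA t\<close> applied to \<open>l\<close> reduces to
  \<open>transA_l l t\<close>; an explicit substitution into a translation reduces to the translation
  of the substituted term; and \<open>l\<close> occurs in \<open>transA_l l t\<close> outside every
  redex pattern, so that a step of \<open>l\<close> is a step of \<open>transA_l l t\<close>.
\<close>

section \<open>Reduction\<close>

abbreviation step_tm :: "'s tm \<Rightarrow> 's tm \<Rightarrow> bool" where
  "step_tm \<equiv> ctx_tm (\<lambda>M N. rule_B M N \<or> rule_x_tm M N) rule_x_lst"

abbreviation step_lst :: "'s lst \<Rightarrow> 's lst \<Rightarrow> bool" where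
  "step_lst \<equiv> ctx_lst (\<lambda>M N. rule_B M N \<or> rule_x_tm M N) rule_x_lst"

lemma step_tm_B: "rule_B M N \<Longrightarrow> step_tm M N"
  and step_tm_x: "rule_x_tm M N \<Longrightarrow> step_tm M N"
  and step_lst_x: "rule_x_lst l k \<Longrightarrow> step_lst l k"
  by (simp_all add: ctx_tm_ctx_lst.root_tm ctx_tm_ctx_lst.root_lst)

lemmas step_tm_rules = step_tm_B[OF B] rule_x_tm.intros[THEN step_tm_x]
lemmas step_lst_rules = rule_x_lst.intros[THEN step_lst_x]

lemma rtranclp_cong:
  assumes "\<And>x y. R x y \<Longrightarrow> S (f x) (f y)" and "R\<^sup>*\<^sup>* x y"
  shows "S\<^sup>*\<^sup>* (f x) (f y)"
  using assms(2) by induction (auto intro: rtranclp.rtrancl_into_rtrancl assms(1))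

lemma tranclp_cong:
  assumes "\<And>x y. R x y \<Longrightarrow> S (f x) (f y)" and "R\<^sup>+\<^sup>+ x y"
  shows "S\<^sup>+\<^sup>+ (f x) (f y)"
  using assms(2) by induction (auto intro: tranclp.trancl_into_trancl assms(1))

text \<open>
  The general transitivity rules for closures have a flexible head \<open>?r ?a ?b\<close>, on which
  calculational reasoning diverges when the terms are large.
\<close>

lemma step_tm_trans [trans]:
  fixes M N K :: "'s tm"
  shows "step_tm M N \<Longrightarrow> step_tm\<^sup>*\<^sup>* N K \<Longrightarrow> step_tm\<^sup>*\<^sup>* M K"
    and "step_tm\<^sup>*\<^sup>* M N \<Longrightarrow> step_tm N K \<Longrightarrow> step_tm\<^sup>*\<^sup>* M K"
    and "step_tm\<^sup>*\<^sup>* M N \<Longrightarrow> step_tm\<^sup>*\<^sup>* N K \<Longrightarrow> step_tm\<^sup>*\<^sup>* M K"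
    and "step_tm\<^sup>+\<^sup>+ M N \<Longrightarrow> step_tm N K \<Longrightarrow> step_tm\<^sup>+\<^sup>+ M K"
    and "step_tm\<^sup>+\<^sup>+ M N \<Longrightarrow> step_tm\<^sup>*\<^sup>* N K \<Longrightarrow> step_tm\<^sup>+\<^sup>+ M K"
  by (rule converse_rtranclp_into_rtranclp rtranclp.rtrancl_into_rtrancl rtranclp_trans
      tranclp.trancl_into_trancl tranclp_rtranclp_tranclp; assumption)+

lemma step_lst_trans [trans]:
  fixes M N K :: "'s lst"
  shows "step_lst M N \<Longrightarrow> step_lst\<^sup>*\<^sup>* N K \<Longrightarrow> step_lst\<^sup>*\<^sup>* M K"
  by (rule converse_rtranclp_into_rtranclp)

section \<open>Congruence of many-step reduction\<close>

lemma steps_Pi: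
  assumes "step_tm\<^sup>*\<^sup>* T T'" and "step_tm\<^sup>*\<^sup>* U U'"
  shows "step_tm\<^sup>*\<^sup>* (Pi T U) (Pi T' U')"
  using rtranclp_cong[OF _ assms(1), of step_tm "\<lambda>T. Pi T U"]
    rtranclp_cong[OF _ assms(2), of step_tm "Pi T'"]
  by (meson ctx_tm_ctx_lst.Pi1 ctx_tm_ctx_lst.Pi2 rtranclp_trans)

lemma steps_Lam:
  assumes "step_tm\<^sup>*\<^sup>* T T'" and "step_tm\<^sup>*\<^sup>* M M'"
  shows "step_tm\<^sup>*\<^sup>* (Lam T M) (Lam T' M')"
  using rtranclp_cong[OF _ assms(1), of step_tm "\<lambda>T. Lam T M"]
    rtranclp_cong[OF _ assms(2), of step_tm "Lam T'"]
  by (meson ctx_tm_ctx_lst.Lam1 ctx_tm_ctx_lst.Lam2 rtranclp_trans)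

lemma steps_App1: "step_tm\<^sup>*\<^sup>* M M' \<Longrightarrow> step_tm\<^sup>*\<^sup>* (App M l) (App M' l)"
  by (rule rtranclp_cong[where f = "\<lambda>M. App M l"]) (rule ctx_tm_ctx_lst.App1)

lemma steps_LCons1: "step_tm\<^sup>*\<^sup>* M M' \<Longrightarrow> step_lst\<^sup>*\<^sup>* (LCons M l) (LCons M' l)"
  by (rule rtranclp_cong[where f = "\<lambda>M. LCons M l"]) (rule ctx_tm_ctx_lst.LCons1)

lemma steps_LAppend1: "step_lst\<^sup>*\<^sup>* l l' \<Longrightarrow> step_lst\<^sup>*\<^sup>* (LAppend l k) (LAppend l' k)"
  by (rule rtranclp_cong[where f = "\<lambda>l. LAppend l k"]) (rule ctx_tm_ctx_lst.LAppend1)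

text \<open>The elements are reduced one after another from the left; \<open>f\<close> stands for
  either kind of meta-variable, so that terms and lists share the argument.\<close>

lemma steps_args:
  assumes "list_all2 step_tm\<^sup>*\<^sup>* Ms Ns"
    and "\<And>Ms M M' Ns. step_tm M M' \<Longrightarrow> R (f (Ms @ M # Ns)) (f (Ms @ M' # Ns))"
  shows "R\<^sup>*\<^sup>* (f Ms) (f Ns)"
proof -
  \<comment> \<open>The prefix \<open>Ks\<close> collects the elements already reduced and grows
    along the induction.\<close>
  have "R\<^sup>*\<^sup>* (f (Ks @ Ms)) (f (Ks @ Ns))" for Ks
    using assms(1)
  proof (induction arbitrary: Ks)
    case (Cons M Ms N Ns)
    have "R\<^sup>*\<^sup>* (f (Ks @ M # Ms)) (f (Ks @ N # Ms))"
      by (rule rtranclp_cong[where f = "\<lambda>M. f (Ks @ M # Ms)", OF _ Cons(1)]) (rule assms(2))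
    also have "R\<^sup>*\<^sup>* \<dots> (f (Ks @ N # Ns))"
      using Cons.IH[of "Ks @ [N]"] by simp
    finally show ?case .
  qed simp
  from this[of "[]"] show ?thesis by simp
qed

lemma steps_TMeta:
  "list_all2 step_tm\<^sup>*\<^sup>* Ms Ns \<Longrightarrow> step_tm\<^sup>*\<^sup>* (TMeta a Ms) (TMeta a Ns)"
  by (erule steps_args) (rule ctx_tm_ctx_lst.TMeta)

lemma steps_LMeta:
  "list_all2 step_tm\<^sup>*\<^sup>* Ms Ns \<Longrightarrow> step_lst\<^sup>*\<^sup>* (LMeta b Ms) (LMeta b Ns)"
  by (erule steps_args) (rule ctx_tm_ctx_lst.LMeta)

section \<open>Preservation of arities\<close>

lemma ptsc_ren:
  fixes M :: "'s tm" and l :: "'s lst"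
  shows "ptsc_tm tar lar (ren_tm f M) = ptsc_tm tar lar M"
  and "ptsc_lst tar lar (ren_lst f l) = ptsc_lst tar lar l"
  by (induction M and l arbitrary: f and f) (auto simp: list_all_iff)

text \<open>\<open>C_alpha\<close> and \<open>D_beta\<close> map over the argument list and so keep
  its length; the renamings in \<open>C1\<close> and \<open>C5\<close> are harmless by
  \<open>ptsc_ren\<close>.\<close>

lemma step_ptsc:
  fixes M N :: "'s tm" and l k :: "'s lst"
  shows "step_tm M N \<Longrightarrow> ptsc_tm tar lar M \<Longrightarrow> ptsc_tm tar lar N"
  and "step_lst l k \<Longrightarrow> ptsc_lst tar lar l \<Longrightarrow> ptsc_lst tar lar k"
  by (induction rule: ctx_tm_ctx_lst.inducts)
    (auto simp: ptsc_ren list_all_iff elim!: rule_B.cases rule_x_tm.cases rule_x_lst.cases)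

text \<open>\<open>red_Bx\<close> asks every term on the way to respect the arities. Preservation
  reduces this to the starting term, so the simulation can be proved for the unrestricted
  \<open>step_tm\<close>.\<close>

lemma tranclp_step_red_Bx:
  assumes "step_tm\<^sup>+\<^sup>+ M N" and "ptsc_tm tar lar M"
  shows "(red_Bx tar lar)\<^sup>+\<^sup>+ M N"
proof -
  have "(red_Bx tar lar)\<^sup>+\<^sup>+ M N \<and> ptsc_tm tar lar N"
    using assms
  proof (induction rule: tranclp_induct)
    case (base N)
    then show ?case
      by (auto simp: red_Bx_def step_ptsc)
  next
    case (step N K)
    then have "red_Bx tar lar N K"
      by (auto simp: red_Bx_def step_ptsc)
    with step show ?case
      by (auto simp: red_Bx_def intro: tranclp.trancl_into_trancl)
  qed
  then show ?thesis ..
qed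

section \<open>PTS terms and their heads\<close>

abbreviation papps :: "'s pts \<Rightarrow> 's pts list \<Rightarrow> 's pts" where
  "papps \<equiv> foldl PApp"

lemma papps_head_args: "papps (head t) (args t) = t"
  by (induction t) auto

lemma head_papps: "head (papps h ts) = head h"
  and args_papps: "args (papps h ts) = args h @ ts"
  by (induction ts rule: rev_induct) auto

lemma pren_papps: "pren f (papps h ts) = papps (pren f h) (map (pren f) ts)"
  by (induction ts rule: rev_induct) auto

lemma psubst_papps: "psubst g (papps h ts) = papps (psubst g h) (map (psubst g) ts)"
  by (induction ts rule: rev_induct) auto

text \<open>A reserved head never becomes an abstraction, so the spine contains no redex and the
  step lies inside one argument. Hence saturated reserved variables stay saturated.\<close>

lemma red_beta_papps:
  assumes "red_beta (papps h ts) u" and "h = TRes a \<or> h = LRes b"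
  shows "\<exists>rs t t' ss. ts = rs @ t # ss \<and> red_beta t t' \<and> u = papps h (rs @ t' # ss)"
  using assms(1)
proof (induction ts arbitrary: u rule: rev_induct)
  case Nil
  then show ?case
    using assms(2) by (auto elim: red_beta.cases)
next
  case (snoc t ts)
  from snoc.prems have "red_beta (PApp (papps h ts) t) u"
    by simp
  then show ?case
  proof cases
    case (beta v s)
    then have "head (papps h ts) = PLam v s"
      by simp
    then show ?thesis
      using assms(2) by (auto simp: head_papps)
  next
    case (PApp1 s)
    then obtain rs r r' ss where "ts = rs @ r # ss" "red_beta r r'" "s = papps h (rs @ r' # ss)"
      using snoc.IH by blast
    with PApp1 show ?thesis
      by (intro exI[of _ rs] exI[of _ r] exI[of _ r'] exI[of _ "ss @ [t]"]) simp
  next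
    case (PApp2 t')
    then show ?thesis
      by (intro exI[of _ ts] exI[of _ t] exI[of _ t'] exI[of _ "[]"]) simp
  qed
qed

section \<open>Composition of renamings and substitutions\<close>

lemma up_comp: "up f \<circ> up g = up (f \<circ> g)"
  by (auto simp: up_def fun_eq_iff split: nat.splits)

lemma pren_pren: "pren f (pren g t) = pren (f \<circ> g) t"
  by (induction t arbitrary: f g) (simp_all add: up_comp)

lemma pup_up: "pup g \<circ> up f = pup (g \<circ> f)"
  by (auto simp: pup_def up_def fun_eq_iff split: nat.splits)

lemma psubst_pren: "psubst g (pren f t) = psubst (g \<circ> f) t"
  by (induction t arbitrary: f g) (simp_all add: pup_up)

text \<open>Under a binder the substituted variable has index 1; swapping 0 and 1 makes it index 0
  again, with \<open>u\<close> shifted. This is the PTS counterpart of the exchange in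
  \<open>C1\<close> and \<open>C5\<close>.\<close>

lemma pup_swap:
  "pup (case_nat u PVar) = case_nat (pren Suc u) PVar \<circ> id(0 := 1, 1 := 0)"
  by (auto simp: pup_def fun_eq_iff split: nat.splits)

lemma psubst_swap:
  "psubst (case_nat (pren Suc u) PVar) (pren (id(0 := 1, 1 := 0)) t)
    = psubst (pup (case_nat u PVar)) t"
  by (simp add: psubst_pren pup_swap)

lemma size_papps: "t \<in> set ts \<Longrightarrow> size t < size (papps h ts)"
  for t :: "'s pts"
  using size_args[of t "papps h ts"] by (simp add: args_papps)

section \<open>Saturated reserved variables\<close>

context
  fixes tar lar :: "nat \<Rightarrow> nat"
begin

abbreviation ok :: "'s pts \<Rightarrow> bool" where
  "ok \<equiv> res_ok tar lar 0"

lemma res_ok_mono: "res_ok tar lar m t \<Longrightarrow> m \<le> n \<Longrightarrow> res_ok tar lar n t"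
  by (induction t arbitrary: m n) auto

text \<open>The converse fails, since \<open>t\<close> may be headed by a reserved variable that
  lacks just the argument \<open>u\<close>; \<open>ok_saturated_cases\<close> describes that
  situation.\<close>

lemma ok_PApp: "ok t \<Longrightarrow> ok u \<Longrightarrow> ok (PApp t u)"
  using res_ok_mono[of 0 t 1] by simp

lemma res_ok_papps:
  "res_ok tar lar n (papps h ts) \<longleftrightarrow> res_ok tar lar (n + length ts) h \<and> list_all ok ts"
  by (induction ts arbitrary: n rule: rev_induct) auto

lemma res_ok_pren: "res_ok tar lar n (pren f t) = res_ok tar lar n t"
  by (induction t arbitrary: n f) auto

lemma res_ok_psubst:
  assumes "res_ok tar lar n t" and "\<And>x. ok (g x)"
  shows "res_ok tar lar n (psubst g t)"
  using assms
proof (induction t arbitrary: n g)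
  case (PVar x)
  then show ?case
    \<comment> \<open>The variable may stand in head position with \<open>n\<close> arguments,
      whereas \<open>g x\<close> is only known to be good with none.\<close>
    by (auto intro: res_ok_mono)
next
  case (PPi T U)
  have "ok (pup g x)" for x
    using PPi.prems by (simp add: pup_def res_ok_pren split: nat.split)
  with PPi show ?case by simp
next
  case (PLam T U)
  have "ok (pup g x)" for x
    using PLam.prems by (simp add: pup_def res_ok_pren split: nat.split)
  with PLam show ?case by simp
qed auto

lemma ok_subst1: "ok u \<Longrightarrow> ok t \<Longrightarrow> ok (psubst (case_nat u PVar) t)"
  by (rule res_ok_psubst) (auto split: nat.split)

lemma res_ok_red: "red_beta t u \<Longrightarrow> res_ok tar lar n t \<Longrightarrow> res_ok tar lar n u"
proof (induction arbitrary: n rule: red_beta.induct)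
  case (beta v t u)
  then show ?case
    by (auto intro!: ok_subst1 intro: res_ok_mono[of 0])
qed auto

text \<open>The arguments of \<open>t\<close> are good, so only its head can make it fail: a
  reserved variable with enough arguments in \<open>PApp t u\<close> but too few in
  \<open>t\<close>. As the two counts differ by one, the number is exact.\<close>

lemma ok_saturated_cases:
  assumes "ok (PApp t u)" and "\<not> ok t"
  obtains a ts where "PApp t u = papps (TRes a) ts" "length ts = tar a" "list_all ok ts"
  | b s ts where "PApp t u = papps (LRes b) (s # ts)" "length ts = lar b" "list_all ok (s # ts)"
proof -
  define h where "h = head t"
  define ts where "ts = args t @ [u]"
  have t: "t = papps h (args t)"
    by (simp add: h_def papps_head_args)
  have h_not_PApp: "h \<noteq> PApp r r'" for r r'
    unfolding h_def by (induction t) auto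
  from t have eq: "PApp t u = papps h ts"
    by (simp add: ts_def)
  have ok: "list_all ok ts" "res_ok tar lar (length ts) h"
    using assms(1) unfolding eq res_ok_papps by auto
  have "\<not> res_ok tar lar (length (args t)) h"
    using assms(2) ok(1) res_ok_papps[of 0 h "args t"] t by (simp add: ts_def)
  moreover have "length ts = Suc (length (args t))"
    by (simp add: ts_def)
  ultimately consider a where "h = TRes a" "length ts = tar a"
    | b where "h = LRes b" "length ts = Suc (lar b)"
    using ok(2) h_not_PApp by (cases h) auto
  then show ?thesis
  proof cases
    case 1
    then show ?thesis
      using that(1) eq ok(1) by blast
  next
    case 2
    then obtain s ss where "ts = s # ss" "length ss = lar b"
      by (auto simp: length_Suc_conv)
    then show ?thesis
      using that(2) eq ok(1) 2 by blast
  qed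
qed

text \<open>In the application case \<open>t\<close> is already good, so \<open>u\<close> comes on
  top of whatever the head requires. The proof is by induction on size, because the arguments of a
  saturated reserved variable are not all immediate subterms.\<close>

lemma ok_induct [consumes 1, case_names PVar PSort PPi PLam PApp TRes LRes]:
  assumes "ok t"
    and "\<And>x. P (PVar x)"
    and "\<And>s. P (PSort s)"
    and "\<And>T U. ok T \<Longrightarrow> ok U \<Longrightarrow> P T \<Longrightarrow> P U \<Longrightarrow> P (PPi T U)"
    and "\<And>T t. ok T \<Longrightarrow> ok t \<Longrightarrow> P T \<Longrightarrow> P t \<Longrightarrow> P (PLam T t)"
    and "\<And>t u. ok t \<Longrightarrow> ok u \<Longrightarrow> P t \<Longrightarrow> P u \<Longrightarrow> P (PApp t u)"
    and saturated_TRes: "\<And>a ts. length ts = tar a \<Longrightarrow> list_all ok ts \<Longrightarrow> list_all P ts \<Longrightarrow>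
      P (papps (TRes a) ts)"
    and saturated_LRes: "\<And>b t ts. length ts = lar b \<Longrightarrow> ok t \<Longrightarrow> list_all ok ts \<Longrightarrow>
      P t \<Longrightarrow> list_all P ts \<Longrightarrow> P (papps (LRes b) (t # ts))"
  shows "P t"
  using assms(1)
proof (induction t rule: measure_induct_rule[of size])
  case (less t)
  show ?case
  proof (cases t)
    case (TRes a)
    then show ?thesis
      \<comment> \<open>A bare \<open>TRes a\<close> is good only at arity 0, where it is saturated
        by the empty list.\<close>
      using less.prems saturated_TRes[of "[]" a] by simp
  next
    case (PApp t1 u)
    show ?thesis
    proof (cases "ok t1")
      case True
      then show ?thesis
        using less PApp assms(6) by simp
    next
      case False
      from less.prems[unfolded PApp] False show ?thesis
      proof (cases rule: ok_saturated_cases)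
        case (1 a ts)
        then have "list_all P ts"
          using less.IH PApp by (simp add: list_all_iff size_papps)
        with 1 PApp show ?thesis
          using saturated_TRes by simp
      next
        case (2 b s ts)
        then have "list_all P (s # ts)"
          using less.IH PApp size_papps[of _ "s # ts" "LRes b"] unfolding list_all_iff by metis
        with 2 PApp show ?thesis
          using saturated_LRes[of ts b s] by simp
      qed
    qed
  qed (use less assms in auto)
qed

section \<open>The translation\<close>

abbreviation A :: "'s pts \<Rightarrow> 's tm" where
  "A \<equiv> transA tar lar"

abbreviation A_l :: "'s lst \<Rightarrow> 's pts \<Rightarrow> 's tm" where
  "A_l \<equiv> transA_l tar lar"

text \<open>One further argument exceeds the exact number, so the saturated branches of the
  translation do not apply to \<open>PApp t u\<close> when \<open>t\<close> is good.\<close>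

lemma ok_args_length:
  assumes "ok t"
  shows "head t = TRes a \<Longrightarrow> tar a \<le> length (args t)"
    and "head t = LRes b \<Longrightarrow> lar b < length (args t)"
  using assms res_ok_papps[of 0 "head t" "args t"] unfolding papps_head_args by auto

lemma A_l_PApp: "ok t \<Longrightarrow> A_l l (PApp t u) = A_l (LCons (A u) l) t"
  using ok_args_length[of t]
  by (auto split: pts.split list.split simp: append_eq_Cons_conv)

lemma A_PApp: "ok t \<Longrightarrow> A (PApp t u) = A_l LNil (PApp t u)"
  using ok_args_length[of t]
  by (auto split: pts.split list.split simp: append_eq_Cons_conv)

lemma A_l_TRes:
  "length ts = tar a \<Longrightarrow> A_l l (papps (TRes a) ts) = App (TMeta a (map A ts)) l"
  by (cases ts rule: rev_cases) (auto simp: head_papps args_papps)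

lemma A_TRes: "length ts = tar a \<Longrightarrow> A (papps (TRes a) ts) = TMeta a (map A ts)"
  by (cases ts rule: rev_cases) (auto simp: head_papps args_papps)

text \<open>The translation singles out the first argument, while \<open>papps\<close> exposes the
  last one in \<open>PApp\<close>; splitting \<open>t # ts\<close> from the right makes the defining
  equation applicable.\<close>

lemma A_l_LRes:
  assumes "length ts = lar b"
  shows "A_l l (papps (LRes b) (t # ts)) = A_l (LAppend (LMeta b (map A ts)) l) t"
proof -
  obtain rs r where eq: "t # ts = rs @ [r]"
    by (metis list.distinct(1) rev_exhaust)
  then have "papps (LRes b) (t # ts) = PApp (papps (LRes b) rs) r"
    unfolding eq by simp
  then show ?thesis
    using assms by (simp add: head_papps args_papps eq[symmetric] del: foldl_Cons)
qed

lemma A_LRes: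
  assumes "length ts = lar b"
  shows "A (papps (LRes b) (t # ts)) = A_l (LMeta b (map A ts)) t"
proof -
  obtain rs r where eq: "t # ts = rs @ [r]"
    by (metis list.distinct(1) rev_exhaust)
  then have "papps (LRes b) (t # ts) = PApp (papps (LRes b) rs) r"
    unfolding eq by simp
  then show ?thesis
    using assms by (simp add: head_papps args_papps eq[symmetric] del: foldl_Cons)
qed

declare transA.simps [simp del] transA_l.simps(4) [simp del]

lemma A_PVar: "A (PVar x) = Var x LNil"
  by (simp add: transA.simps)

text \<open>Equations that follow the cases of \<open>ok_induct\<close>, in place of the defining
  ones that inspect \<open>head\<close> and \<open>args\<close>.\<close>

lemmas A_simps = transA.simps(1-3) A_PVar A_PApp A_TRes A_LRes A_l_PApp A_l_TRes A_l_LRes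

text \<open>Saturation gives every meta-variable exactly as many arguments as its arity.\<close>

lemma ptsc_A:
  assumes "ok t"
  shows "ptsc_tm tar lar (A t) \<and> (\<forall>l. ptsc_lst tar lar l \<longrightarrow> ptsc_tm tar lar (A_l l t))"
  using assms
  by (induction rule: ok_induct) (auto simp: A_simps list_all_iff simp del: foldl_Cons)

text \<open>\<open>C1\<close> and \<open>C5\<close> shift and swap indices in translations, and the
  results have to be translations again.\<close>

lemma ren_A:
  assumes "ok t"
  shows "ren_tm f (A t) = A (pren f t) \<and> (\<forall>l. ren_tm f (A_l l t) = A_l (ren_lst f l) (pren f t))"
  using assms
  by (induction arbitrary: f rule: ok_induct)
    (auto simp: A_simps pren_papps res_ok_pren list_all_iff comp_def
      simp del: foldl_Cons cong: map_cong)

text \<open>The recursive clauses merely wrap \<open>l\<close> in \<open>LCons\<close> or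
  \<open>LAppend\<close>, and the final ones put the list under \<open>Var\<close> or
  \<open>App\<close>; all these are contexts.\<close>

lemma step_A_l: "ok t \<Longrightarrow> step_lst l k \<Longrightarrow> step_tm (A_l l t) (A_l k t)"
  by (induction t arbitrary: l k rule: ok_induct)
    (auto simp: A_simps simp del: foldl_Cons intro: ctx_tm_ctx_lst.intros)

lemma steps_A_l: "ok t \<Longrightarrow> step_lst\<^sup>*\<^sup>* l k \<Longrightarrow> step_tm\<^sup>*\<^sup>* (A_l l t) (A_l k t)"
  by (rule rtranclp_cong[where f = "\<lambda>l. A_l l t"]) (rule step_A_l)

text \<open>\<open>B2\<close> or \<open>B3\<close> appends \<open>k\<close> to the list at the head;
  \<open>A1\<close> and \<open>A3\<close> then move the append inwards past each accumulated
  argument or list meta-variable.\<close>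

lemma A_l_App:
  assumes "ok t"
  shows "step_tm\<^sup>*\<^sup>* (App (A_l l t) k) (A_l (LAppend l k) t)"
  using assms
proof (induction t arbitrary: l rule: ok_induct)
  case (PApp t u)
  have "step_tm\<^sup>*\<^sup>* (App (A_l (LCons (A u) l) t) k) (A_l (LAppend (LCons (A u) l) k) t)"
    by (rule PApp.IH)
  also have "step_tm \<dots> (A_l (LCons (A u) (LAppend l k)) t)"
    by (intro step_A_l PApp.hyps step_lst_rules)
  finally show ?case
    using PApp.hyps by (simp add: A_l_PApp)
next
  case (LRes b t ts)
  let ?m = "LMeta b (map A ts)"
  have "step_tm\<^sup>*\<^sup>* (App (A_l (LAppend ?m l) t) k) (A_l (LAppend (LAppend ?m l) k) t)"
    by (rule LRes.IH)
  also have "step_tm \<dots> (A_l (LAppend ?m (LAppend l k)) t)"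
    by (intro step_A_l LRes.hyps step_lst_rules)
  finally show ?case
    using LRes.hyps by (simp add: A_l_LRes del: foldl_Cons)
qed (auto simp: A_l_TRes intro: step_tm_rules)

text \<open>For variables and ordinary applications \<open>A t\<close> accumulates onto
  \<open>LNil\<close>, which \<open>A2\<close> removes after the append. A saturated list
  meta-variable needs \<open>A_l_App\<close> alone, and elsewhere the two sides coincide.\<close>

lemma A_App:
  assumes "ok t"
  shows "step_tm\<^sup>*\<^sup>* (App (A t) l) (A_l l t)"
  using assms
proof (induction t rule: ok_induct)
  case (PVar x)
  have "step_tm\<^sup>*\<^sup>* (App (Var x LNil) l) (Var x (LAppend LNil l))"
    by (rule r_into_rtranclp) (rule step_tm_rules)
  also have "step_tm \<dots> (Var x l)"
    by (intro ctx_tm_ctx_lst.Var step_lst_rules)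
  finally show ?case
    by (simp add: A_PVar)
next
  case (PApp t u)
  then have ok: "ok (PApp t u)"
    by (intro ok_PApp)
  have "step_tm\<^sup>*\<^sup>* (App (A_l LNil (PApp t u)) l) (A_l (LAppend LNil l) (PApp t u))"
    using ok by (rule A_l_App)
  also have "step_tm \<dots> (A_l l (PApp t u))"
    using ok by (intro step_A_l step_lst_rules)
  finally show ?case
    using PApp.hyps by (simp add: A_PApp)
next
  case (LRes b t ts)
  then show ?case
    using A_l_App[of t "LMeta b (map A ts)" l] by (simp add: A_simps del: foldl_Cons)
qed (auto simp: transA.simps(1-3) A_TRes A_l_TRes)

text \<open>Where the two translations differ, \<open>B1\<close> removes the empty list after a
  sort, binder or term meta-variable, and \<open>A4\<close> removes it behind a list
  meta-variable.\<close>

lemma A_l_LNil: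
  assumes "ok t"
  shows "step_tm\<^sup>*\<^sup>* (A_l LNil t) (A t)"
  using assms
  by (induction t rule: ok_induct)
    (auto simp: A_simps simp del: foldl_Cons intro!: r_into_rtranclp
      intro: step_tm_rules step_A_l step_lst_rules)

section \<open>Substitution and simulation\<close>

lemma steps_Sub_App:
  "step_tm\<^sup>*\<^sup>* (Sub P G M) N \<Longrightarrow> step_tm\<^sup>*\<^sup>* (Sub P G (App M l)) (App N (LSub P G l))"
  by (rule converse_rtranclp_into_rtranclp[of step_tm, OF step_tm_x[OF C4]]) (rule steps_App1)

lemma A_shift: "ok u \<Longrightarrow> shift (A u) = A (pren Suc u)"
  and A_swap: "ok t \<Longrightarrow> swap (A t) = A (pren (id(0 := 1, 1 := 0)) t)"
  by (simp_all add: ren_A)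

text \<open>Derives the claim of \<open>Sub_A\<close> about \<open>A\<close> from the one about
  \<open>A_l\<close> when the translation starts from \<open>LNil\<close>: \<open>D1\<close> erases
  the substitution on the empty list.\<close>

lemma Sub_A_from_LNil:
  assumes "ok t" and "\<And>l. step_tm\<^sup>*\<^sup>* M (A_l (LSub P G LNil) t)"
  shows "step_tm\<^sup>*\<^sup>* M (A t)"
proof -
  have "step_tm\<^sup>*\<^sup>* M (A_l (LSub P G LNil) t)"
    by (rule assms(2))
  also have "step_tm \<dots> (A_l LNil t)"
    by (intro step_A_l assms(1) step_lst_rules)
  also have "step_tm\<^sup>*\<^sup>* \<dots> (A t)"
    by (rule A_l_LNil[OF assms(1)])
  finally show ?thesis .
qed

text \<open>Brings the induction hypothesis for a swapped body into the form that \<open>C1\<close>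
  and \<open>C5\<close> produce.\<close>

lemma Sub_A_binder:
  assumes "ok t" and "ok u"
    and "step_tm\<^sup>*\<^sup>* (Sub (A (pren Suc u)) G (A (pren (id(0 := 1, 1 := 0)) t)))
      (A (psubst (case_nat (pren Suc u) PVar) (pren (id(0 := 1, 1 := 0)) t)))"
  shows "step_tm\<^sup>*\<^sup>* (Sub (shift (A u)) G (swap (A t))) (A (psubst (pup (case_nat u PVar)) t))"
  using assms(3) unfolding psubst_swap A_shift[OF assms(2)] A_swap[OF assms(1)] .

text \<open>After \<open>C1\<close> or \<open>C5\<close> the body is a swapped copy of a subterm,
  not the subterm itself. Generalising over a renaming \<open>f\<close> makes the induction
  hypothesis applicable to it; \<open>u\<close> and \<open>G\<close> vary because they are
  shifted.\<close>

lemma Sub_A: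
  fixes t u :: "'s pts"
  assumes "ok t" and "ok u"
  shows "step_tm\<^sup>*\<^sup>* (Sub (A u) G (A (pren f t))) (A (psubst (case_nat u PVar) (pren f t))) \<and>
    (\<forall>l. step_tm\<^sup>*\<^sup>* (Sub (A u) G (A_l l (pren f t)))
      (A_l (LSub (A u) G l) (psubst (case_nat u PVar) (pren f t))))"
  using assms
proof (induction t arbitrary: f u G rule: ok_induct)
  case (PVar x)
  \<comment> \<open>Index 0 fires \<open>C2\<close>, after which \<open>A_App\<close> feeds the list
    to the translation of \<open>u\<close>; any other index fires \<open>C3\<close>.\<close>
  have *: "step_tm\<^sup>*\<^sup>* (Sub (A u) G (Var (f x) l)) (A_l (LSub (A u) G l) (case_nat u PVar (f x)))" for l
  proof (cases "f x")
    case 0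
    have "step_tm (Sub (A u) G (Var 0 l)) (App (A u) (LSub (A u) G l))"
      by (rule step_tm_rules)
    also have "step_tm\<^sup>*\<^sup>* \<dots> (A_l (LSub (A u) G l) u)"
      by (rule A_App[OF PVar])
    finally show ?thesis
      using 0 by simp
  next
    case (Suc y)
    then show ?thesis
      by (auto intro: step_tm_rules)
  qed
  have "ok (case_nat u PVar (f x))"
    using PVar by (simp split: nat.split)
  from Sub_A_from_LNil[OF this *] * show ?case
    by (simp add: A_PVar)
next
  case (PSort s)
  have "step_tm\<^sup>*\<^sup>* (Sub (A u) G (Sort s)) (Sort s)"
    by (rule r_into_rtranclp) (rule step_tm_rules)
  then show ?case
    by (simp add: transA.simps steps_Sub_App)
next
  case (PPi T U)
  have "step_tm (Sub (A u) G (Pi (A (pren f T)) (A (pren (up f) U))))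
    (Pi (Sub (A u) G (A (pren f T))) (Sub (shift (A u)) (shift G) (swap (A (pren (up f) U)))))"
    by (rule step_tm_rules)
  also have "step_tm\<^sup>*\<^sup>* \<dots> (Pi (A (psubst (case_nat u PVar) (pren f T)))
      (A (psubst (pup (case_nat u PVar)) (pren (up f) U))))"
  proof (rule steps_Pi)
    show "step_tm\<^sup>*\<^sup>* (Sub (A u) G (A (pren f T))) (A (psubst (case_nat u PVar) (pren f T)))"
      by (rule conjunct1[OF PPi.IH(1)[OF PPi.prems]])
    show "step_tm\<^sup>*\<^sup>* (Sub (shift (A u)) (shift G) (swap (A (pren (up f) U))))
      (A (psubst (pup (case_nat u PVar)) (pren (up f) U)))"
      \<comment> \<open>The renaming composes the swap with \<open>up f\<close>, since the swap acts
        on a body already renamed under its binder.\<close>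
      using PPi.IH(2)[of "pren Suc u" "shift G" "id(0 := 1, 1 := 0) \<circ> up f"] PPi.hyps PPi.prems
      by (intro Sub_A_binder) (simp_all only: res_ok_pren pren_pren)
  qed
  finally show ?case
    by (simp add: transA.simps steps_Sub_App)
next
  case (PLam T t)
  have "step_tm (Sub (A u) G (Lam (A (pren f T)) (A (pren (up f) t))))
    (Lam (Sub (A u) G (A (pren f T))) (Sub (shift (A u)) (shift G) (swap (A (pren (up f) t)))))"
    by (rule step_tm_rules)
  also have "step_tm\<^sup>*\<^sup>* \<dots> (Lam (A (psubst (case_nat u PVar) (pren f T)))
      (A (psubst (pup (case_nat u PVar)) (pren (up f) t))))"
  proof (rule steps_Lam)
    show "step_tm\<^sup>*\<^sup>* (Sub (A u) G (A (pren f T))) (A (psubst (case_nat u PVar) (pren f T)))"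
      by (rule conjunct1[OF PLam.IH(1)[OF PLam.prems]])
    show "step_tm\<^sup>*\<^sup>* (Sub (shift (A u)) (shift G) (swap (A (pren (up f) t))))
      (A (psubst (pup (case_nat u PVar)) (pren (up f) t)))"
      using PLam.IH(2)[of "pren Suc u" "shift G" "id(0 := 1, 1 := 0) \<circ> up f"] PLam.hyps PLam.prems
      by (intro Sub_A_binder) (simp_all only: res_ok_pren pren_pren)
  qed
  finally show ?case
    by (simp add: transA.simps steps_Sub_App)
next
  case (PApp t v)
  let ?s = "\<lambda>t. psubst (case_nat u PVar) (pren f t)"
  have ok: "ok (pren f t)" "ok (?s t)" "ok (?s v)"
    using PApp.hyps PApp.prems by (simp_all only: ok_subst1 res_ok_pren)
  \<comment> \<open>The hypothesis for \<open>t\<close> carries the substitution to the accumulated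
    list; \<open>D2\<close> splits it there, and the hypothesis for \<open>v\<close> finishes the
    argument.\<close>
  have *: "step_tm\<^sup>*\<^sup>* (Sub (A u) G (A_l (LCons (A (pren f v)) l) (pren f t)))
      (A_l (LCons (A (?s v)) (LSub (A u) G l)) (?s t))" for l
  proof -
    have "step_tm\<^sup>*\<^sup>* (Sub (A u) G (A_l (LCons (A (pren f v)) l) (pren f t)))
        (A_l (LSub (A u) G (LCons (A (pren f v)) l)) (?s t))"
      using PApp.IH(1)[OF PApp.prems] by simp
    also have "step_tm \<dots> (A_l (LCons (Sub (A u) G (A (pren f v))) (LSub (A u) G l)) (?s t))"
      by (intro step_A_l ok step_lst_rules)
    also have "step_tm\<^sup>*\<^sup>* \<dots> (A_l (LCons (A (?s v)) (LSub (A u) G l)) (?s t))"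
      by (rule steps_A_l[OF ok(2) steps_LCons1[OF conjunct1[OF PApp.IH(2)[OF PApp.prems]]]])
    finally show ?thesis .
  qed
  have "ok (PApp (?s t) (?s v))"
    using ok by (intro ok_PApp)
  from Sub_A_from_LNil[OF this *[folded A_l_PApp[OF ok(2)]]] * show ?case
    using ok by (simp add: A_simps)
next
  case (TRes a ts)
  let ?s = "\<lambda>t. psubst (case_nat u PVar) (pren f t)"
  have "step_tm (Sub (A u) G (TMeta a (map (\<lambda>t. A (pren f t)) ts)))
      (TMeta a (map (Sub (A u) G) (map (\<lambda>t. A (pren f t)) ts)))"
    by (rule step_tm_rules)
  also have "step_tm\<^sup>*\<^sup>* \<dots> (TMeta a (map (\<lambda>t. A (?s t)) ts))"
    using TRes.IH TRes.prems
    by (intro steps_TMeta) (simp add: list_all2_conv_all_nth list_all_length)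
  finally show ?case
    using TRes.hyps by (simp add: pren_papps psubst_papps A_simps comp_def steps_Sub_App)
next
  case (LRes b t ts)
  let ?s = "\<lambda>t. psubst (case_nat u PVar) (pren f t)"
  let ?m = "LMeta b (map (\<lambda>t. A (pren f t)) ts)"
  let ?m' = "LMeta b (map (\<lambda>t. A (?s t)) ts)"
  have ok: "ok (?s t)"
    using LRes.hyps LRes.prems by (simp only: ok_subst1 res_ok_pren)
  have IH: "step_tm\<^sup>*\<^sup>* (Sub (A u) G (A_l l (pren f t))) (A_l (LSub (A u) G l) (?s t))" for l
    using LRes.IH(1)[OF LRes.prems] by simp
  have "step_lst (LSub (A u) G ?m) (LMeta b (map (Sub (A u) G) (map (\<lambda>t. A (pren f t)) ts)))"
    by (rule step_lst_rules)
  also have "step_lst\<^sup>*\<^sup>* \<dots> ?m'"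
    using LRes.IH(2) LRes.prems
    by (intro steps_LMeta) (simp add: list_all2_conv_all_nth list_all_length)
  finally have m: "step_lst\<^sup>*\<^sup>* (LSub (A u) G ?m) ?m'" .
  have 1: "step_tm\<^sup>*\<^sup>* (Sub (A u) G (A_l ?m (pren f t))) (A_l ?m' (?s t))"
    using IH steps_A_l[OF ok m] by (rule rtranclp_trans)
  \<comment> \<open>With a tail \<open>l\<close>, \<open>D3\<close> first separates it from the
    meta-variable.\<close>
  have 2: "step_tm\<^sup>*\<^sup>* (Sub (A u) G (A_l (LAppend ?m l) (pren f t)))
      (A_l (LAppend ?m' (LSub (A u) G l)) (?s t))" for l
  proof -
    have "step_tm\<^sup>*\<^sup>* (Sub (A u) G (A_l (LAppend ?m l) (pren f t)))
        (A_l (LSub (A u) G (LAppend ?m l)) (?s t))"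
      by (rule IH)
    also have "step_tm \<dots> (A_l (LAppend (LSub (A u) G ?m) (LSub (A u) G l)) (?s t))"
      by (intro step_A_l ok step_lst_rules)
    also have "step_tm\<^sup>*\<^sup>* \<dots> (A_l (LAppend ?m' (LSub (A u) G l)) (?s t))"
      by (intro steps_A_l ok steps_LAppend1 m)
    finally show ?thesis .
  qed
  from 1 2 show ?case
    using LRes.hyps by (simp add: pren_papps psubst_papps A_simps comp_def del: foldl_Cons)
qed

corollary Sub_A_subst1:
  assumes "ok t" and "ok u"
  shows "step_tm\<^sup>*\<^sup>* (Sub (A u) G (A t)) (A (psubst (case_nat u PVar) t))"
proof -
  have "up id = id"
    by (auto simp: up_def fun_eq_iff split: nat.split)
  then have "pren id t = t"
    by (induction t) simp_all
  with Sub_A[OF assms, of G id] show ?thesis by simp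
qed

section \<open>Congruence of non-empty reduction\<close>

lemma steps1_A_l: "ok t \<Longrightarrow> step_lst\<^sup>+\<^sup>+ l k \<Longrightarrow> step_tm\<^sup>+\<^sup>+ (A_l l t) (A_l k t)"
  by (rule tranclp_cong[where f = "\<lambda>l. A_l l t"]) (rule step_A_l)

lemma steps1_Pi1: "step_tm\<^sup>+\<^sup>+ M M' \<Longrightarrow> step_tm\<^sup>+\<^sup>+ (Pi M N) (Pi M' N)"
  by (rule tranclp_cong[where f = "\<lambda>M. Pi M N"]) (rule ctx_tm_ctx_lst.Pi1)

lemma steps1_Pi2: "step_tm\<^sup>+\<^sup>+ M M' \<Longrightarrow> step_tm\<^sup>+\<^sup>+ (Pi N M) (Pi N M')"
  by (rule tranclp_cong[where f = "Pi N"]) (rule ctx_tm_ctx_lst.Pi2)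

lemma steps1_Lam1: "step_tm\<^sup>+\<^sup>+ M M' \<Longrightarrow> step_tm\<^sup>+\<^sup>+ (Lam M N) (Lam M' N)"
  by (rule tranclp_cong[where f = "\<lambda>M. Lam M N"]) (rule ctx_tm_ctx_lst.Lam1)

lemma steps1_Lam2: "step_tm\<^sup>+\<^sup>+ M M' \<Longrightarrow> step_tm\<^sup>+\<^sup>+ (Lam N M) (Lam N M')"
  by (rule tranclp_cong[where f = "Lam N"]) (rule ctx_tm_ctx_lst.Lam2)

lemma steps1_App1: "step_tm\<^sup>+\<^sup>+ M M' \<Longrightarrow> step_tm\<^sup>+\<^sup>+ (App M l) (App M' l)"
  by (rule tranclp_cong[where f = "\<lambda>M. App M l"]) (rule ctx_tm_ctx_lst.App1)

lemma steps1_LCons1: "step_tm\<^sup>+\<^sup>+ M M' \<Longrightarrow> step_lst\<^sup>+\<^sup>+ (LCons M l) (LCons M' l)"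
  by (rule tranclp_cong[where f = "\<lambda>M. LCons M l"]) (rule ctx_tm_ctx_lst.LCons1)

lemma steps1_LAppend1: "step_lst\<^sup>+\<^sup>+ l l' \<Longrightarrow> step_lst\<^sup>+\<^sup>+ (LAppend l k) (LAppend l' k)"
  by (rule tranclp_cong[where f = "\<lambda>l. LAppend l k"]) (rule ctx_tm_ctx_lst.LAppend1)

lemma steps1_TMeta: "step_tm\<^sup>+\<^sup>+ M M' \<Longrightarrow> step_tm\<^sup>+\<^sup>+ (TMeta a (Ms @ M # Ns)) (TMeta a (Ms @ M' # Ns))"
  by (rule tranclp_cong[where f = "\<lambda>M. TMeta a (Ms @ M # Ns)"]) (rule ctx_tm_ctx_lst.TMeta)

lemma steps1_LMeta: "step_tm\<^sup>+\<^sup>+ M M' \<Longrightarrow> step_lst\<^sup>+\<^sup>+ (LMeta b (Ms @ M # Ns)) (LMeta b (Ms @ M' # Ns))"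
  by (rule tranclp_cong[where f = "\<lambda>M. LMeta b (Ms @ M # Ns)"]) (rule ctx_tm_ctx_lst.LMeta)

section \<open>Strong simulation of beta-reduction\<close>

text \<open>The claim about \<open>A_l\<close> serves a step in function position, where the
  arguments are already on the list. Strictness comes from the \<open>B\<close> step at the redex;
  the other cases pass it through a context.\<close>

lemma red_beta_A:
  assumes "ok t" and "red_beta t u"
  shows "step_tm\<^sup>+\<^sup>+ (A t) (A u) \<and> (\<forall>l. step_tm\<^sup>+\<^sup>+ (A_l l t) (A_l l u))"
  using assms
proof (induction t arbitrary: u rule: ok_induct)
  case (PPi T U)
  from PPi.prems have "step_tm\<^sup>+\<^sup>+ (A (PPi T U)) (A u)"
  proof cases
    case (PPi1 T')
    then show ?thesis
      using PPi.IH by (auto simp: transA.simps intro: steps1_Pi1)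
  next
    case (PPi2 U')
    then show ?thesis
      using PPi.IH by (auto simp: transA.simps intro: steps1_Pi2)
  qed
  \<comment> \<open>As \<open>u\<close> is again a product, both \<open>A_l\<close> translations
    have the form of an \<open>App\<close> to \<open>l\<close>.\<close>
  moreover from PPi.prems obtain T' U' where "u = PPi T' U'"
    by cases auto
  ultimately show ?case
    by (auto intro: steps1_App1)
next
  case (PLam T t)
  from PLam.prems have "step_tm\<^sup>+\<^sup>+ (A (PLam T t)) (A u)"
  proof cases
    case (PLam1 T')
    then show ?thesis
      using PLam.IH by (auto simp: transA.simps intro: steps1_Lam1)
  next
    case (PLam2 t')
    then show ?thesis
      using PLam.IH by (auto simp: transA.simps intro: steps1_Lam2)
  qed
  moreover from PLam.prems obtain T' t' where "u = PLam T' t'"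
    by cases auto
  ultimately show ?case
    by (auto intro: steps1_App1)
next
  case (PApp t v)
  from PApp.prems show ?case
  proof cases
    case (beta T s)
    then have ok: "ok s" "ok (psubst (case_nat v PVar) s)"
      using PApp.hyps by (auto intro: ok_subst1)
    \<comment> \<open>\<open>B\<close> consumes the first list element; carrying out the
      substitution it creates leaves \<open>A u\<close> applied to the tail
      \<open>l\<close>.\<close>
    have red: "step_tm\<^sup>+\<^sup>+ (A_l l (PApp t v)) (App (A u) l)" for l
    proof -
      have "step_tm\<^sup>+\<^sup>+ (A_l l (PApp t v)) (App (Sub (A v) (A T) (A s)) l)"
        using beta PApp.hyps
        by (simp add: A_l_PApp transA.simps step_tm_rules tranclp.r_into_trancl)
      also have "step_tm\<^sup>*\<^sup>* \<dots> (App (A u) l)"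
        using beta PApp.hyps ok by (auto intro: steps_App1 Sub_A_subst1)
      finally show ?thesis .
    qed
    have "step_tm\<^sup>+\<^sup>+ (A (PApp t v)) (App (A u) LNil)"
      using red PApp.hyps by (simp add: A_PApp)
    also have "step_tm \<dots> (A u)"
      by (rule step_tm_rules)
    finally have "step_tm\<^sup>+\<^sup>+ (A (PApp t v)) (A u)" .
    \<comment> \<open>The contractum may have any shape, so \<open>A_App\<close> merges the
      application to \<open>l\<close> into its translation.\<close>
    moreover have "step_tm\<^sup>+\<^sup>+ (A_l l (PApp t v)) (A_l l u)" for l
      using ok(2) unfolding beta(2)[symmetric] by (rule step_tm_trans(5)[OF red A_App])
    ultimately show ?thesis by blast
  next
    case (PApp1 t')
    \<comment> \<open>\<open>t'\<close> must be good again for \<open>PApp t' v\<close> to be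
      translated by the ordinary application equations.\<close>
    with PApp have "ok t'" "\<And>l. step_tm\<^sup>+\<^sup>+ (A_l l t) (A_l l t')"
      by (auto intro: res_ok_red)
    then show ?thesis
      using PApp.hyps PApp1 by (simp add: A_simps)
  next
    case (PApp2 v')
    then have "step_lst\<^sup>+\<^sup>+ (LCons (A v) l) (LCons (A v') l)" for l
      using PApp.IH by (auto intro: steps1_LCons1)
    then show ?thesis
      using PApp.hyps PApp2 by (simp add: A_simps steps1_A_l)
  qed
next
  case (TRes a ts)
  obtain rs t t' ss where ts: "ts = rs @ t # ss" and red: "red_beta t t'"
    and u: "u = papps (TRes a) (rs @ t' # ss)"
    using red_beta_papps[OF TRes.prems] by metis
  have step: "step_tm\<^sup>+\<^sup>+ (TMeta a (map A (rs @ t # ss))) (TMeta a (map A (rs @ t' # ss)))"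
    using TRes.IH red by (simp add: ts steps1_TMeta)
  have len: "length (rs @ t # ss) = tar a" "length (rs @ t' # ss) = tar a"
    using TRes.hyps(1) by (simp_all add: ts)
  show ?case
    unfolding ts u A_TRes[OF len(1)] A_TRes[OF len(2)] A_l_TRes[OF len(1)] A_l_TRes[OF len(2)]
    by (intro conjI allI steps1_App1 step)
next
  case (LRes b t ts)
  obtain rs s s' ss where ts: "t # ts = rs @ s # ss" and red: "red_beta s s'"
    and u: "u = papps (LRes b) (rs @ s' # ss)"
    using red_beta_papps[OF LRes.prems] by metis
  show ?case
  \<comment> \<open>The first argument of a list meta-variable becomes the term that receives the
    list; the later ones become arguments of \<open>LMeta\<close>.\<close>
  proof (cases rs)
    case Nil
    with ts have eq: "s = t" "ss = ts" "rs = []"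
      by simp_all
    show ?thesis
      unfolding u eq append_Nil A_LRes[of ts, OF LRes.hyps(1)] A_l_LRes[of ts, OF LRes.hyps(1)]
      using LRes.IH(1)[OF red[unfolded eq]] by simp
  next
    case (Cons r rs')
    with ts have eq: "r = t" "ts = rs' @ s # ss"
      by simp_all
    have step: "step_lst\<^sup>+\<^sup>+ (LMeta b (map A (rs' @ s # ss))) (LMeta b (map A (rs' @ s' # ss)))"
      using LRes.IH(2) red by (simp add: eq steps1_LMeta)
    have len: "length (rs' @ s # ss) = lar b" "length (rs' @ s' # ss) = lar b"
      using LRes.hyps(1) by (simp_all add: eq)
    show ?thesis
      unfolding u Cons eq append_Cons
        A_LRes[OF len(1)] A_LRes[OF len(2)] A_l_LRes[OF len(1)] A_l_LRes[OF len(2)]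
      by (intro conjI allI steps1_A_l LRes.hyps(2) steps1_LAppend1 step)
  qed
qed (auto elim: red_beta.cases)

end

theorem theorem2p5:
  fixes tar lar :: "nat \<Rightarrow> nat" and t u :: "'s pts"
  assumes "t \<in> PTSalpha tar lar" and "u \<in> PTSalpha tar lar"
    and "red_beta t u"
  shows "(red_Bx tar lar)\<^sup>+\<^sup>+ (transA tar lar t) (transA tar lar u)"
proof (rule tranclp_step_red_Bx)
  have "res_ok tar lar 0 t"
    using assms(1) by (simp add: PTSalpha_def)
  then show "step_tm\<^sup>+\<^sup>+ (transA tar lar t) (transA tar lar u)" "ptsc_tm tar lar (transA tar lar t)"
    using red_beta_A assms(3) ptsc_A by blast+
qed

end
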